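(* Let $\gamma^+>0$, let $\{\gamma_i,i\ge1\}\subset(0,\gamma^+]$, and let $\{\theta_i,X_i\}$ be the controlled Markov chain started at $(\theta_0,X_0)=(\theta,x)\in\Theta\times\mathsf{X}$ and defined for $i\ge0$ by $X_{i+1}\mid(\theta_0,X_0,\ldots,X_i)\sim P_{\theta_i}(X_i,\cdot)$ and $\theta_{i+1}=\phi_{\gamma_{i+1}}(\theta_i,X_{i+1})$. Assume that $\{P_\theta,\theta\in\Theta\}$ and $\{\phi_\gamma,\gamma\in(0,\gamma^+]\}$ satisfy the assumptions (A2) and (A3) described in the context, and that $\{\gamma_i\}$ is such that $$\bar\varepsilon:=\Delta(0)-\limsup_{i\to\infty}(\gamma_{i+1}^{-1}-\gamma_i^{-1})>0.$$ Then for any $\varepsilon\in(0,\bar\varepsilon)$ there exist $\lambda_*\in[1,\infty)$ and $\delta,M_*\in(0,\infty)$ such that for any $\gamma,\bar\gamma\in(0,\gamma^+]$ with $\gamma^{-1}-\bar\gamma^{-1}<\Delta(0)-\varepsilon$ and any $(\theta,x)\notin\mathcal{W}_{M_*}\times\mathsf{C}$, $$P_{\theta,\gamma}\{\lambda_*V+w/\gamma\}(\theta,x)\le\lambda_*V(x)+w(\theta)/\bar\gamma-\delta[V^\iota(x)/a(\theta)+w(\theta)],$$ and such that, with this $M_*$, the set $\mathcal{W}_{M_*}\times\mathsf{C}$ is visited infinitely often by $\{\theta_i,X_i\}$, $\mathbb{P}_{\theta,x}$-a.s. (for any initial $(\theta,x)\in\Theta\times\mathsf{X}$).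
   Context: Setting: $\mathsf{X}\subset\mathbb{R}^{n_x}$, $\Theta\subset\mathbb{R}^{n_\theta}$, $\{P_\theta,\theta\in\Theta\}$ is a family of Markov transition probabilities on $(\mathsf{X},\mathcal{B}(\mathsf{X}))$, $\{\phi_\gamma:\Theta\times\mathsf{X}\to\Theta,\gamma\in(0,\gamma^+]\}$ is a family of mappings, and $P_\theta f(x):=\int_{\mathsf{X}}P_\theta(x,\mathrm{d}y)f(y)$. For $f$ defined on $\Theta\times\mathsf{X}$, $P_{\theta,\gamma}f(\theta,x):=\int_{\mathsf{X}}P_\theta(x,\mathrm{d}y)f(\phi_\gamma(\theta,y),y)$; functions of $\theta$ only or of $x$ only are viewed as functions on $\Theta\times\mathsf{X}$. $\mathbb{P}_{\theta,x}$ is the law of $\{\theta_i,X_i\}$ started at $(\theta,x)$. $\mathcal{W}_M:=\{\theta\in\Theta:w(\theta)\le M\}$, $A^c$ denotes the complement of $A$, $a^{-1}(\theta):=1/a(\theta)$ (similarly $e^{-p}(\theta)=e(\theta)^{-p}$), $u\vee v:=\max\{u,v\}$. Assumption (A2): there exist $V:\mathsf{X}\to[1,\infty)$ and $\mathsf{C}\subset\mathsf{X}$ with $\sup_{x\in\mathsf{C}}V(x)<\infty$, functions $a,b:\Theta\to[0,\infty)$ and $\iota\in[0,1]$ such that for all $(\theta,x)\in\Theta\times\mathsf{X}$, $$P_\theta V(x)\le[V(x)-a^{-1}(\theta)V^\iota(x)]\mathbb{I}\{x\notin\mathsf{C}\}+b(\theta)\mathbb{I}\{x\in\mathsf{C}\}.$$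 Assumption (A3): with $V,\mathsf{C},a,b,\iota$ as in (A2), there exists $w:\Theta\to[1,\infty)$ such that: (1) for any $M>0$, $\sup_{\theta\in\mathcal{W}_M}a(\theta)<\infty$, and $\lim_{M\to\infty}\sup_{\theta\in\mathcal{W}_M^c}b(\theta)/w(\theta)=0$; (2) there exist $\beta\in[0,1]$, $c,d:\Theta\to[0,\infty)$ and $e:\Theta\to[1,\infty)$ such that for all $\gamma\in(0,\gamma^+]$ and $(\theta,x)\in\Theta\times\mathsf{X}$, $$P_{\theta,\gamma}w(\theta,x)\le w(\theta)-\gamma w(\theta)\Delta\left(V_\beta(\theta,x)\mathbb{I}\{x\notin\mathsf{C}\}+d(\theta)\mathbb{I}\{x\in\mathsf{C}\}\right),\quad V_\beta(\theta,x):=c(\theta)+V^\beta(x)/e(\theta);$$ (3) $c,d$ are bounded, $\lim_{M\to\infty}\sup_{\theta\in\mathcal{W}_M^c}[c(\theta)\vee d(\theta)]=0$, and for any $M>0$, $\sup_{\theta\in\mathcal{W}_M}e(\theta)<\infty$; (4) $\Delta:[0,\infty)\to\mathbb{R}$ is such that (a) $\Delta(0)>0$ and $\Delta$ is continuous in a neighborhood of $0$; (b) there exists $p_\Delta\in(0,\iota/\beta]$ such that for all $M>0$ there exists $C_{\Delta,M}>0$ with $|\Delta(z)|\le C_{\Delta,M}z^{p_\Delta}$ for all $z\ge M$; (5) for any $\epsilon>0$, $$\sup_{(\theta,x)\in\tilde{\mathcal{V}}_\epsilon}\frac{a(\theta)w(\theta)e^{-p_\Delta}(\theta)}{V^{\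iota-p_\Delta\beta}(x)}<\infty,\qquad\tilde{\mathcal{V}}_\epsilon:=\{(\theta,x):V^\beta(x)/e(\theta)\ge\epsilon\}.$$
   Formalization: The function a is taken strictly positive, so that 1/a is defined, and in the case C = X it is also assumed bounded away from 0 on Θ; without this the drift inequality can fail when C = X, and for C ≠ X it follows from (A2). *)

theory Defs
  imports "HOL-Probability.Probability"
begin

abbreviation borel_on :: "'a::topological_space set \<Rightarrow> 'a measure"
  where "borel_on S \<equiv> restrict_space borel S"

text \<open>
  \<^term>\<open>P \<theta> x\<close> is the transition probability from \<^term>\<open>x\<close>, and \<^term>\<open>\<phi> \<gamma> \<theta> y\<close> the parameter update.
  Since the parameter used at each step depends on the past of the chain, the law of the chain exists
  only if these maps are measurable jointly in parameter and state.
\<close>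

definition controlled_family ::
    "'x::euclidean_space set \<Rightarrow> 't::euclidean_space set \<Rightarrow> ('t \<Rightarrow> 'x \<Rightarrow> 'x measure) \<Rightarrow>
     (real \<Rightarrow> 't \<Rightarrow> 'x \<Rightarrow> 't) \<Rightarrow> real \<Rightarrow> bool"
  where "controlled_family X \<Theta> P \<phi> \<gamma>max \<longleftrightarrow>
    (\<lambda>(\<theta>, x). P \<theta> x) \<in> borel_on \<Theta> \<Otimes>\<^sub>M borel_on X \<rightarrow>\<^sub>M prob_algebra (borel_on X) \<and>
    (\<forall>\<gamma>\<in>{0<..\<gamma>max}. (\<lambda>(\<theta>, y). \<phi> \<gamma> \<theta> y) \<in> borel_on \<Theta> \<Otimes>\<^sub>M borel_on X \<rightarrow>\<^sub>M borel_on \<Theta>)"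

text \<open>
  The operators \<open>P\<^sub>\<theta>\<close> and \<open>P\<^sub>\<theta>\<^sub>,\<^sub>\<gamma>\<close>, for nonnegative functions. They are extended-valued, so that an
  upper bound by a real number includes integrability. They are only applied to functions bounded
  below by a positive constant, hence a bound by \<^term>\<open>ennreal r\<close> is the same as a bound by the real
  number \<^term>\<open>r\<close>, also where \<^term>\<open>r\<close> is negative: both are then false.
\<close>

definition trans_op :: "('t \<Rightarrow> 'x \<Rightarrow> 'x measure) \<Rightarrow> ('x \<Rightarrow> real) \<Rightarrow> 't \<Rightarrow> 'x \<Rightarrow> ennreal"
  where "trans_op P f \<theta> x = (\<integral>\<^sup>+ y. ennreal (f y) \<partial>P \<theta> x)"

definition joint_op ::
    "('t \<Rightarrow> 'x \<Rightarrow> 'x measure) \<Rightarrow> (real \<Rightarrow> 't \<Rightarrow> 'x \<Rightarrow> 't) \<Rightarrow> real \<Rightarrow>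
     ('t \<Rightarrow> 'x \<Rightarrow> real) \<Rightarrow> 't \<Rightarrow> 'x \<Rightarrow> ennreal"
  where "joint_op P \<phi> \<gamma> f \<theta> x = (\<integral>\<^sup>+ y. ennreal (f (\<phi> \<gamma> \<theta> y) y) \<partial>P \<theta> x)"

definition sublevel :: "'t set \<Rightarrow> ('t \<Rightarrow> real) \<Rightarrow> real \<Rightarrow> 't set"
  where "sublevel \<Theta> w M = {\<theta>\<in>\<Theta>. w \<theta> \<le> M}"

text \<open>
  The drift condition on \<^term>\<open>V\<close>. Its right-hand side involves \<^term>\<open>1 / a \<theta>\<close>, whence the requirement
  that \<^term>\<open>a \<theta>\<close> be nonzero. If \<^term>\<open>C\<close> is a proper subset of \<^term>\<open>X\<close>, the condition forces \<^term>\<open>a\<close> to be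
  bounded away from zero, see \<open>state_drift_lower_bound\<close> below. If \<^term>\<open>C = X\<close> it says nothing about
  \<^term>\<open>a\<close>, and a lower bound has to be assumed separately wherever \<^term>\<open>1 / a \<theta>\<close> is to be controlled.
\<close>

definition state_drift ::
    "'x::euclidean_space set \<Rightarrow> 't set \<Rightarrow> ('t \<Rightarrow> 'x \<Rightarrow> 'x measure) \<Rightarrow> ('x \<Rightarrow> real) \<Rightarrow> 'x set \<Rightarrow>
     ('t \<Rightarrow> real) \<Rightarrow> ('t \<Rightarrow> real) \<Rightarrow> real \<Rightarrow> bool"
  where "state_drift X \<Theta> P V C a b \<iota> \<longleftrightarrow>
    V \<in> borel_measurable (borel_on X) \<and> (\<forall>x\<in>X. 1 \<le> V x) \<and>
    C \<subseteq> X \<and> bdd_above (V ` C) \<and>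
    (\<forall>\<theta>\<in>\<Theta>. 0 < a \<theta> \<and> 0 \<le> b \<theta>) \<and> 0 \<le> \<iota> \<and> \<iota> \<le> 1 \<and>
    (\<forall>\<theta>\<in>\<Theta>. \<forall>x\<in>X. trans_op P V \<theta> x \<le>
       ennreal ((V x - V x powr \<iota> / a \<theta>) * indicator (X - C) x + b \<theta> * indicator C x))"

lemma state_drift_lower_bound:
  assumes fam: "controlled_family X \<Theta> P \<phi> \<gamma>max" and drift: "state_drift X \<Theta> P V C a b \<iota>"
    and "C \<noteq> X"
  shows "\<exists>a0>0. \<forall>\<theta>\<in>\<Theta>. a0 \<le> a \<theta>"
proof -
  have "C \<subseteq> X" using drift unfolding state_drift_def by (elim conjE)
  with \<open>C \<noteq> X\<close> obtain x where x: "x \<in> X" "x \<notin> C" by blast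
  have "\<forall>y\<in>X. 1 \<le> V y" using drift unfolding state_drift_def by (elim conjE)
  then have V1: "1 \<le> V y" if "y \<in> X" for y using that by blast
  have "\<forall>\<theta>\<in>\<Theta>. 0 < a \<theta> \<and> 0 \<le> b \<theta>" using drift unfolding state_drift_def by (elim conjE)
  then have a: "0 < a \<theta>" if "\<theta> \<in> \<Theta>" for \<theta> using that by blast
  have \<iota>: "0 \<le> \<iota>" using drift unfolding state_drift_def by (elim conjE)
  have PV: "\<forall>\<theta>\<in>\<Theta>. \<forall>x\<in>X. trans_op P V \<theta> x \<le>
      ennreal ((V x - V x powr \<iota> / a \<theta>) * indicator (X - C) x + b \<theta> * indicator C x)"
    using drift unfolding state_drift_def by (elim conjE)
  have meas: "(\<lambda>(\<theta>, x). P \<theta> x) \<in> borel_on \<Theta> \<Otimes>\<^sub>M borel_on X \<rightarrow>\<^sub>M prob_algebra (borel_on X)"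
    using fam unfolding controlled_family_def by (elim conjE)
  have *: "1 / V x \<le> a \<theta>" if \<theta>: "\<theta> \<in> \<Theta>" for \<theta>
  proof -
    have "P \<theta> x \<in> space (prob_algebra (borel_on X))"
      using measurable_space[OF meas, of "(\<theta>, x)"] \<theta> x
      by (simp add: space_pair_measure space_restrict_space)
    then have "prob_space (P \<theta> x)" and sets: "sets (P \<theta> x) = sets (borel_on X)"
      by (auto simp: space_prob_algebra)
    then interpret prob_space "P \<theta> x" by simp
    have sp: "space (P \<theta> x) = X"
      using sets_eq_imp_space_eq[OF sets] by (simp add: space_restrict_space)
    have "(1::ennreal) = (\<integral>\<^sup>+ y. 1 \<partial>P \<theta> x)" by (simp add: emeasure_space_1)
    also have "\<dots> \<le> trans_op P V \<theta> x"
      unfolding trans_op_def using V1 by (intro nn_integral_mono) (auto simp: sp)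
    also have "\<dots> \<le> ennreal ((V x - V x powr \<iota> / a \<theta>) * indicator (X - C) x + b \<theta> * indicator C x)"
      using PV \<theta> x(1) by blast
    finally have "ennreal 1 \<le> ennreal (V x - V x powr \<iota> / a \<theta>)" using x by simp
    then have "V x powr \<iota> / a \<theta> \<le> V x"
      by (subst (asm) ennreal_le_iff2) auto
    moreover have "1 \<le> V x powr \<iota>" using V1[OF x(1)] \<iota> by (rule ge_one_powr_ge_zero)
    then have "1 / a \<theta> \<le> V x powr \<iota> / a \<theta>" using a[OF \<theta>] by (simp add: divide_right_mono)
    ultimately have "1 / a \<theta> \<le> V x" by linarith
    then show ?thesis using a[OF \<theta>] V1[OF x(1)] by (simp add: field_simps)
  qed
  have "0 < 1 / V x" using V1[OF x(1)] by simp
  then show ?thesis using * by blast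
qed

text \<open>
  In \<open>parameter_drift\<close>, \<^term>\<open>p * \<beta> \<le> \<iota>\<close> is \<open>p \<le> \<iota> / \<beta>\<close> with the quotient read as \<open>\<infinity>\<close> for \<open>\<beta> = 0\<close>
  (HOL has \<open>\<iota> / 0 = 0\<close>). Suprema over complements of sublevel sets are taken in \<^typ>\<open>ennreal\<close>, where
  the supremum of the empty set is \<open>0\<close>.
\<close>

definition parameter_drift ::
    "'x::euclidean_space set \<Rightarrow> 't::euclidean_space set \<Rightarrow> ('t \<Rightarrow> 'x \<Rightarrow> 'x measure) \<Rightarrow>
     (real \<Rightarrow> 't \<Rightarrow> 'x \<Rightarrow> 't) \<Rightarrow> real \<Rightarrow> ('x \<Rightarrow> real) \<Rightarrow> 'x set \<Rightarrow> ('t \<Rightarrow> real) \<Rightarrow> ('t \<Rightarrow> real) \<Rightarrow>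
     real \<Rightarrow> ('t \<Rightarrow> real) \<Rightarrow> real \<Rightarrow> ('t \<Rightarrow> real) \<Rightarrow> ('t \<Rightarrow> real) \<Rightarrow> ('t \<Rightarrow> real) \<Rightarrow>
     (real \<Rightarrow> real) \<Rightarrow> real \<Rightarrow> bool"
  where "parameter_drift X \<Theta> P \<phi> \<gamma>max V C a b \<iota> w \<beta> c d e \<Delta> p \<longleftrightarrow>
    w \<in> borel_measurable (borel_on \<Theta>) \<and> (\<forall>\<theta>\<in>\<Theta>. 1 \<le> w \<theta>) \<and>
    (\<forall>M>0. bdd_above (a ` sublevel \<Theta> w M)) \<and>
    ((\<lambda>M. SUP \<theta>\<in>\<Theta> - sublevel \<Theta> w M. ennreal (b \<theta> / w \<theta>)) \<longlongrightarrow> 0) at_top \<and>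
    0 \<le> \<beta> \<and> \<beta> \<le> 1 \<and> (\<forall>\<theta>\<in>\<Theta>. 0 \<le> c \<theta> \<and> 0 \<le> d \<theta> \<and> 1 \<le> e \<theta>) \<and>
    (\<forall>\<gamma>\<in>{0<..\<gamma>max}. \<forall>\<theta>\<in>\<Theta>. \<forall>x\<in>X. joint_op P \<phi> \<gamma> (\<lambda>\<theta> x. w \<theta>) \<theta> x \<le>
       ennreal (w \<theta> - \<gamma> * w \<theta> *
         \<Delta> ((c \<theta> + V x powr \<beta> / e \<theta>) * indicator (X - C) x + d \<theta> * indicator C x))) \<and>
    bdd_above (c ` \<Theta>) \<and> bdd_above (d ` \<Theta>) \<and>
    ((\<lambda>M. SUP \<theta>\<in>\<Theta> - sublevel \<Theta> w M. ennreal (max (c \<theta>) (d \<theta>))) \<longlongrightarrow> 0) at_top \<and>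
    (\<forall>M>0. bdd_above (e ` sublevel \<Theta> w M)) \<and>
    0 < \<Delta> 0 \<and> (\<exists>r>0. continuous_on {0..<r} \<Delta>) \<and>
    0 < p \<and> p * \<beta> \<le> \<iota> \<and> (\<forall>M>0. \<exists>K>0. \<forall>z\<ge>M. \<bar>\<Delta> z\<bar> \<le> K * z powr p) \<and>
    (\<forall>\<epsilon>>0. bdd_above ((\<lambda>(\<theta>, x). a \<theta> * w \<theta> * e \<theta> powr (- p) / V x powr (\<iota> - p * \<beta>)) `
       {(\<theta>, x). \<theta> \<in> \<Theta> \<and> x \<in> X \<and> V x powr \<beta> / e \<theta> \<ge> \<epsilon>}))"

primrec param_seq ::
    "(real \<Rightarrow> 't \<Rightarrow> 'x \<Rightarrow> 't) \<Rightarrow> (nat \<Rightarrow> real) \<Rightarrow> 't \<Rightarrow> (nat \<Rightarrow> 'x) \<Rightarrow> nat \<Rightarrow> 't"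
  where
    "param_seq \<phi> \<gamma> \<theta> \<omega> 0 = \<theta>"
  | "param_seq \<phi> \<gamma> \<theta> \<omega> (Suc i) = \<phi> (\<gamma> (Suc i)) (param_seq \<phi> \<gamma> \<theta> \<omega> i) (\<omega> (Suc i))"

text \<open>
  The chain is realised on its path space: \<open>X\<^sub>i\<close> is the \<open>i\<close>-th coordinate \<^term>\<open>\<omega> i\<close> and \<open>\<theta>\<^sub>i\<close> is
  \<^term>\<open>param_seq \<phi> \<gamma> \<theta> \<omega> i\<close>. The function \<open>chain_kernel\<close> gives the conditional distribution of the
  \<open>i\<close>-th coordinate given the preceding ones, and \<open>chain_law\<close> is the measure on path space that the
  Ionescu-Tulcea theorem assigns to these kernels.
\<close>

definition chain_kernel ::
    "'x::euclidean_space set \<Rightarrow> ('t \<Rightarrow> 'x \<Rightarrow> 'x measure) \<Rightarrow> (real \<Rightarrow> 't \<Rightarrow> 'x \<Rightarrow> 't) \<Rightarrow>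
     (nat \<Rightarrow> real) \<Rightarrow> 't \<Rightarrow> 'x \<Rightarrow> nat \<Rightarrow> (nat \<Rightarrow> 'x) \<Rightarrow> 'x measure"
  where "chain_kernel X P \<phi> \<gamma> \<theta> x i \<omega> =
    (case i of 0 \<Rightarrow> return (borel_on X) x | Suc j \<Rightarrow> P (param_seq \<phi> \<gamma> \<theta> \<omega> j) (\<omega> j))"

definition chain_law ::
    "'x::euclidean_space set \<Rightarrow> ('t \<Rightarrow> 'x \<Rightarrow> 'x measure) \<Rightarrow> (real \<Rightarrow> 't \<Rightarrow> 'x \<Rightarrow> 't) \<Rightarrow>
     (nat \<Rightarrow> real) \<Rightarrow> 't \<Rightarrow> 'x \<Rightarrow> (nat \<Rightarrow> 'x) measure"
  where "chain_law X P \<phi> \<gamma> \<theta> x =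
    projective_family.lim UNIV
      (Ionescu_Tulcea.CI (chain_kernel X P \<phi> \<gamma> \<theta> x) (\<lambda>_. borel_on X)) (\<lambda>_. borel_on X)"

lemma measurable_param_seq:
  fixes \<phi> :: "real \<Rightarrow> 't::euclidean_space \<Rightarrow> 'x::euclidean_space \<Rightarrow> 't"
  assumes fam: "controlled_family X \<Theta> P \<phi> \<gamma>max"
    and steps: "\<forall>i\<ge>1. \<gamma> i \<in> {0<..\<gamma>max}" and \<theta>: "\<theta> \<in> \<Theta>" and n: "n < m"
  shows "(\<lambda>\<omega>. param_seq \<phi> \<gamma> \<theta> \<omega> n) \<in> PiM {0..<m} (\<lambda>_. borel_on X) \<rightarrow>\<^sub>M borel_on \<Theta>"
  using n
proof (induction n)
  case 0
  then show ?case using \<theta> by (simp add: space_restrict_space)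
next
  case (Suc n)
  have 1: "(\<lambda>(\<theta>, y). \<phi> (\<gamma> (Suc n)) \<theta> y) \<in> borel_on \<Theta> \<Otimes>\<^sub>M borel_on X \<rightarrow>\<^sub>M borel_on \<Theta>"
    using fam steps unfolding controlled_family_def by auto
  have 2: "(\<lambda>\<omega>. (param_seq \<phi> \<gamma> \<theta> \<omega> n, \<omega> (Suc n)))
      \<in> PiM {0..<m} (\<lambda>_. borel_on X) \<rightarrow>\<^sub>M borel_on \<Theta> \<Otimes>\<^sub>M borel_on X"
    using Suc by (intro measurable_Pair measurable_component_singleton) auto
  show ?case using measurable_compose[OF 2 1] by simp
qed

lemma Ionescu_Tulcea_chain_kernel:
  fixes \<phi> :: "real \<Rightarrow> 't::euclidean_space \<Rightarrow> 'x::euclidean_space \<Rightarrow> 't"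
  assumes fam: "controlled_family X \<Theta> P \<phi> \<gamma>max"
    and steps: "\<forall>i\<ge>1. \<gamma> i \<in> {0<..\<gamma>max}" and \<theta>: "\<theta> \<in> \<Theta>" and x: "x \<in> X"
  shows "Ionescu_Tulcea (chain_kernel X P \<phi> \<gamma> \<theta> x) (\<lambda>_. borel_on X)"
proof -
  have K: "chain_kernel X P \<phi> \<gamma> \<theta> x i
      \<in> PiM {0..<i} (\<lambda>_. borel_on X) \<rightarrow>\<^sub>M prob_algebra (borel_on X)" for i
  proof (cases i)
    case 0
    have "return (borel_on X) x \<in> space (prob_algebra (borel_on X))"
      using x by (simp add: space_prob_algebra prob_space_return space_restrict_space)
    then show ?thesis
      unfolding 0 chain_kernel_def by simp
  next
    case (Suc j)
    have 1: "(\<lambda>(\<theta>, x). P \<theta> x) \<in> borel_on \<Theta> \<Otimes>\<^sub>M borel_on X \<rightarrow>\<^sub>M prob_algebra (borel_on X)"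
      using fam unfolding controlled_family_def by auto
    have 2: "(\<lambda>\<omega>. (param_seq \<phi> \<gamma> \<theta> \<omega> j, \<omega> j))
        \<in> PiM {0..<Suc j} (\<lambda>_. borel_on X) \<rightarrow>\<^sub>M borel_on \<Theta> \<Otimes>\<^sub>M borel_on X"
      using measurable_param_seq[OF fam steps \<theta>]
      by (intro measurable_Pair measurable_component_singleton) auto
    show ?thesis
      unfolding Suc chain_kernel_def using measurable_compose[OF 2 1] by simp
  qed
  show ?thesis
  proof (rule Ionescu_Tulcea.intro)
    show "chain_kernel X P \<phi> \<gamma> \<theta> x i
        \<in> PiM {0..<i} (\<lambda>_. borel_on X) \<rightarrow>\<^sub>M subprob_algebra (borel_on X)" for i
      using K by (rule measurable_prob_algebraD)
    show "prob_space (chain_kernel X P \<phi> \<gamma> \<theta> x i \<omega>)"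
      if "\<omega> \<in> space (PiM {0..<i} (\<lambda>_. borel_on X))" for i \<omega>
      using measurable_space[OF K that] by (simp add: space_prob_algebra)
  qed
qed

end

theory Submission
  imports Defs
begin

text \<open>
  Off \<open>C\<close>, the excess \<open>w (\<Delta> 0 - \<epsilon> - \<Delta> z)\<close> with \<open>z = c + V\<^sup>\<beta> / e\<close> is negative for small \<open>z\<close> by continuity
  of \<open>\<Delta>\<close> at \<open>0\<close>, and otherwise the growth bound on \<open>\<Delta>\<close> and the bound on \<open>a w / (e\<^sup>p V\<^sup>\<iota>\<^sup>-\<^sup>p\<^sup>\<beta>)\<close> dominate it by a
  multiple of \<open>V\<^sup>\<iota> / a\<close>, which a large weight \<open>lam\<close> on the drift of \<open>V\<close> absorbs. On \<open>C\<close>, both \<open>b / w\<close>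
  and \<open>d\<close> are small once \<open>w\<close> is large.

  Recurrence follows from the drift of \<open>lam V(X\<^sub>i) + w(\<theta>\<^sub>i) / \<gamma>\<^sub>i\<close> by at least \<open>\<delta>\<close> off the target set. These
  variables need not be integrable, so the process is restricted, from a late time \<open>k\<close> on, to the event
  that its value at time \<open>k\<close> is at most \<open>N\<close>. Since \<open>C\<close> need not be measurable, the non-visiting times
  are enlarged to those at which the drift inequality holds, which is a measurable condition.
\<close>

section \<open>Pointwise bounds from the limit and continuity assumptions\<close>

text \<open>On \<open>\<Theta>\<close>, the complement of the sublevel set is where
  \<open>M < w \<theta>\<close>, and the supremum over it dominates each value.
  \<open>ennreal\<close> sends negative values to \<open>0\<close>, which does no harm because
  \<open>\<eta>\<close> is positive.\<close>

lemma tail_SUP_tendsto_0_imp_bound: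
  fixes f :: "'t \<Rightarrow> real"
  assumes "((\<lambda>M. SUP \<theta>\<in>\<Theta> - sublevel \<Theta> w M. ennreal (f \<theta>)) \<longlongrightarrow> 0) at_top" and "0 < \<eta>"
  shows "\<exists>M0. \<forall>M\<ge>M0. \<forall>\<theta>\<in>\<Theta>. M < w \<theta> \<longrightarrow> f \<theta> < \<eta>"
proof -
  have "eventually (\<lambda>M. (SUP \<theta>\<in>\<Theta> - sublevel \<Theta> w M. ennreal (f \<theta>)) < ennreal \<eta>) at_top"
    using assms by (intro order_tendstoD(2)[OF assms(1)]) simp
  then obtain M0 where M0: "\<And>M. M \<ge> M0 \<Longrightarrow> (SUP \<theta>\<in>\<Theta> - sublevel \<Theta> w M. ennreal (f \<theta>)) < ennreal \<eta>"
    unfolding eventually_at_top_linorder by blast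
  have "f \<theta> < \<eta>" if "M \<ge> M0" "\<theta> \<in> \<Theta>" "M < w \<theta>" for \<theta> M
  proof -
    have "ennreal (f \<theta>) \<le> (SUP \<theta>\<in>\<Theta> - sublevel \<Theta> w M. ennreal (f \<theta>))"
      using that by (intro SUP_upper) (auto simp: sublevel_def)
    also have "\<dots> < ennreal \<eta>" using M0 that by blast
    finally show ?thesis
      by (metis assms(2) ennreal_leI linorder_not_less order_less_imp_le)
  qed
  then show ?thesis by blast
qed

lemma continuous_lower_bound_near_0:
  fixes \<Delta> :: "real \<Rightarrow> real"
  assumes "continuous_on {0..<r} \<Delta>" "0 < r" "0 < \<epsilon>"
  shows "\<exists>\<eta>>0. \<forall>z\<in>{0..\<eta>}. \<Delta> 0 - \<epsilon> \<le> \<Delta> z"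
proof -
  have "0 \<in> {0..<r}" using assms(2) by simp
  then have "\<exists>s>0. \<forall>z\<in>{0..<r}. dist z 0 < s \<longrightarrow> dist (\<Delta> z) (\<Delta> 0) < \<epsilon>"
    using assms(1,3) unfolding continuous_on_iff by blast
  then obtain s where s: "0 < s" "\<And>z. z \<in> {0..<r} \<Longrightarrow> dist z 0 < s \<Longrightarrow> dist (\<Delta> z) (\<Delta> 0) < \<epsilon>"
    by blast
  have "\<Delta> 0 - \<epsilon> \<le> \<Delta> z" if "z \<in> {0..min r s / 2}" for z
  proof -
    have "dist (\<Delta> z) (\<Delta> 0) < \<epsilon>"
      using that s(1) assms(2) by (intro s(2)) (auto simp: dist_real_def min_def split: if_splits)
    then show ?thesis unfolding dist_real_def by linarith
  qed
  moreover have "0 < min r s / 2" using s(1) assms(2) by simp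
  ultimately show ?thesis by blast
qed

section \<open>Drift of the combination \<open>lam * V + w / \<gamma>\<close>\<close>

text \<open>Linearity of the integral gives the upper bound. The lower bound, which comes from
  \<open>V \<ge> 1\<close> and \<open>lam \<ge> 1\<close>, later shows that a real number bounding
  the operator is at least \<open>1\<close>, so that a decrement can be moved across
  \<open>ennreal\<close>.\<close>

lemma joint_op_combination_le:
  fixes P :: "'t::euclidean_space \<Rightarrow> 'x::euclidean_space \<Rightarrow> 'x measure"
  assumes fam: "controlled_family X \<Theta> P \<phi> \<gamma>max" and \<gamma>: "\<gamma> \<in> {0<..\<gamma>max}"
    and V: "V \<in> borel_measurable (borel_on X)" "\<And>x. x \<in> X \<Longrightarrow> 1 \<le> V x"
    and w: "w \<in> borel_measurable (borel_on \<Theta>)" "\<And>\<theta>. \<theta> \<in> \<Theta> \<Longrightarrow> 1 \<le> w \<theta>"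
    and \<theta>: "\<theta> \<in> \<Theta>" and x: "x \<in> X" and lam: "1 \<le> lam"
    and rV: "trans_op P V \<theta> x \<le> ennreal rV"
    and rw: "joint_op P \<phi> \<gamma> (\<lambda>\<theta> x. w \<theta>) \<theta> x \<le> ennreal rw"
  shows "joint_op P \<phi> \<gamma> (\<lambda>\<theta> x. lam * V x + w \<theta> / \<gamma>) \<theta> x \<le> ennreal (lam * rV + rw / \<gamma>)"
    and "1 \<le> joint_op P \<phi> \<gamma> (\<lambda>\<theta> x. lam * V x + w \<theta> / \<gamma>) \<theta> x"
proof -
  have meas: "(\<lambda>(\<theta>, x). P \<theta> x) \<in> borel_on \<Theta> \<Otimes>\<^sub>M borel_on X \<rightarrow>\<^sub>M prob_algebra (borel_on X)"
    and phi: "(\<lambda>(\<theta>, y). \<phi> \<gamma> \<theta> y) \<in> borel_on \<Theta> \<Otimes>\<^sub>M borel_on X \<rightarrow>\<^sub>M borel_on \<Theta>"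
    using fam \<gamma> unfolding controlled_family_def by auto
  have "P \<theta> x \<in> space (prob_algebra (borel_on X))"
    using measurable_space[OF meas, of "(\<theta>, x)"] \<theta> x
    by (simp add: space_pair_measure space_restrict_space)
  then have "prob_space (P \<theta> x)" and sets[measurable_cong]: "sets (P \<theta> x) = sets (borel_on X)"
    by (auto simp: space_prob_algebra)
  then interpret prob_space "P \<theta> x" by simp
  have sp: "space (P \<theta> x) = X"
    using sets_eq_imp_space_eq[OF sets] by (simp add: space_restrict_space)
  have phi1: "\<phi> \<gamma> \<theta> \<in> borel_on X \<rightarrow>\<^sub>M borel_on \<Theta>"
    using measurable_Pair2[OF phi, of \<theta>] \<theta> by (simp add: space_restrict_space)
  have phiT: "\<phi> \<gamma> \<theta> y \<in> \<Theta>" if "y \<in> X" for y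
    using measurable_space[OF phi1, of y] that by (simp add: space_restrict_space)
  note V(1)[measurable]
  have [measurable]: "(\<lambda>y. w (\<phi> \<gamma> \<theta> y)) \<in> borel_measurable (borel_on X)"
    using measurable_compose[OF phi1 w(1)] .
  have \<gamma>0: "0 < \<gamma>" using \<gamma> by simp
  have w0: "0 \<le> w (\<phi> \<gamma> \<theta> y)" if "y \<in> X" for y using w(2)[OF phiT[OF that]] by simp
  have "joint_op P \<phi> \<gamma> (\<lambda>\<theta> x. lam * V x + w \<theta> / \<gamma>) \<theta> x
      = (\<integral>\<^sup>+ y. ennreal lam * ennreal (V y) + ennreal (1 / \<gamma>) * ennreal (w (\<phi> \<gamma> \<theta> y)) \<partial>P \<theta> x)"
    unfolding joint_op_def
  proof (rule nn_integral_cong)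
    fix y assume "y \<in> space (P \<theta> x)"
    then have y: "y \<in> X" by (simp add: sp)
    show "ennreal (lam * V y + w (\<phi> \<gamma> \<theta> y) / \<gamma>)
        = ennreal lam * ennreal (V y) + ennreal (1 / \<gamma>) * ennreal (w (\<phi> \<gamma> \<theta> y))"
      using V(2)[OF y] w0[OF y] lam \<gamma>0
      by (simp add: ennreal_mult[symmetric] ennreal_plus[symmetric] del: ennreal_plus)
  qed
  also have "\<dots> = ennreal lam * trans_op P V \<theta> x + ennreal (1 / \<gamma>) * joint_op P \<phi> \<gamma> (\<lambda>\<theta> x. w \<theta>) \<theta> x"
    unfolding trans_op_def joint_op_def
    by (subst nn_integral_add; (subst nn_integral_cmult)?; (subst nn_integral_cmult)?; measurable)
  finally have eq: "joint_op P \<phi> \<gamma> (\<lambda>\<theta> x. lam * V x + w \<theta> / \<gamma>) \<theta> x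
    = ennreal lam * trans_op P V \<theta> x + ennreal (1 / \<gamma>) * joint_op P \<phi> \<gamma> (\<lambda>\<theta> x. w \<theta>) \<theta> x" .
  have one: "(1::ennreal) = (\<integral>\<^sup>+ y. 1 \<partial>P \<theta> x)" by (simp add: emeasure_space_1)
  have tV: "1 \<le> trans_op P V \<theta> x"
    unfolding trans_op_def using V(2) by (subst one, intro nn_integral_mono) (auto simp: sp)
  have tw: "1 \<le> joint_op P \<phi> \<gamma> (\<lambda>\<theta> x. w \<theta>) \<theta> x"
    unfolding joint_op_def using w(2)[OF phiT] by (subst one, intro nn_integral_mono) (auto simp: sp)
  \<comment> \<open>\<open>ennreal\<close> truncates negative reals, so splitting the right-hand
    side needs nonnegative summands. Both integrals are at least \<open>1\<close>, hence so are
    \<open>rV\<close> and \<open>rw\<close>.\<close>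
  have "1 \<le> rV" using order_trans[OF tV rV] ennreal_le_iff2[of 1 rV] by auto
  moreover have "1 \<le> rw" using order_trans[OF tw rw] ennreal_le_iff2[of 1 rw] by auto
  ultimately have "ennreal (lam * rV + rw / \<gamma>) = ennreal lam * ennreal rV + ennreal (1 / \<gamma>) * ennreal rw"
    using lam \<gamma>0 by (simp add: ennreal_mult[symmetric] ennreal_plus[symmetric] del: ennreal_plus)
  then show "joint_op P \<phi> \<gamma> (\<lambda>\<theta> x. lam * V x + w \<theta> / \<gamma>) \<theta> x \<le> ennreal (lam * rV + rw / \<gamma>)"
    unfolding eq using rV rw by (auto intro!: add_mono mult_left_mono)
  have "1 * 1 \<le> ennreal lam * trans_op P V \<theta> x"
    using lam tV by (intro mult_mono) auto
  then show "1 \<le> joint_op P \<phi> \<gamma> (\<lambda>\<theta> x. lam * V x + w \<theta> / \<gamma>) \<theta> x"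
    unfolding eq by (simp add: add_increasing2)
qed

text \<open>
  If \<open>z\<close> is not small, then neither is \<open>V\<^sup>\<beta> / e\<close>: either \<open>w\<close> is large and \<open>c\<close> is small, or \<open>w\<close> is bounded,
  hence so is \<open>e\<close>, and \<open>V \<ge> 1\<close>.
\<close>

lemma parameter_drift_margin:
  fixes X C :: "'x::euclidean_space set" and \<Theta> :: "'t::euclidean_space set"
  assumes sd: "state_drift X \<Theta> P V C a b \<iota>"
    and pd: "parameter_drift X \<Theta> P \<phi> \<gamma>max V C a b \<iota> w \<beta> c d e \<Delta> p"
    and \<epsilon>: "0 < \<epsilon>"
  shows "\<exists>K\<ge>0. \<forall>\<theta>\<in>\<Theta>. \<forall>x\<in>X.
    w \<theta> * (\<Delta> 0 - \<epsilon> - \<Delta> (c \<theta> + V x powr \<beta> / e \<theta>)) \<le> K * (V x powr \<iota> / a \<theta>)"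
proof -
  have V: "\<And>x. x \<in> X \<Longrightarrow> 1 \<le> V x" and a: "\<And>\<theta>. \<theta> \<in> \<Theta> \<Longrightarrow> 0 < a \<theta>"
    using sd unfolding state_drift_def by auto
  have w: "\<And>\<theta>. \<theta> \<in> \<Theta> \<Longrightarrow> 1 \<le> w \<theta>" and c: "\<And>\<theta>. \<theta> \<in> \<Theta> \<Longrightarrow> 0 \<le> c \<theta>" and e: "\<And>\<theta>. \<theta> \<in> \<Theta> \<Longrightarrow> 1 \<le> e \<theta>"
    and \<beta>: "0 \<le> \<beta>" and p: "0 < p" and D0: "0 < \<Delta> 0"
    using pd unfolding parameter_drift_def by auto
  have "\<exists>r>0. continuous_on {0..<r} \<Delta>"
    using pd unfolding parameter_drift_def by (elim conjE)
  then obtain \<eta> where \<eta>: "0 < \<eta>" and \<Delta>\<eta>: "\<And>z. z \<in> {0..\<eta>} \<Longrightarrow> \<Delta> 0 - \<epsilon> \<le> \<Delta> z"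
    using continuous_lower_bound_near_0[of _ \<Delta> \<epsilon>] \<epsilon> by blast
  have "bdd_above (c ` \<Theta>)"
    using pd unfolding parameter_drift_def by (elim conjE)
  then obtain cb where cb: "\<And>\<theta>. \<theta> \<in> \<Theta> \<Longrightarrow> c \<theta> \<le> cb"
    unfolding bdd_above_def by blast
  have "((\<lambda>M. SUP \<theta>\<in>\<Theta> - sublevel \<Theta> w M. ennreal (max (c \<theta>) (d \<theta>))) \<longlongrightarrow> 0) at_top"
    using pd unfolding parameter_drift_def by (elim conjE)
  from tail_SUP_tendsto_0_imp_bound[OF this half_gt_zero[OF \<eta>]] obtain M0 where
    M0: "\<And>M \<theta>. M \<ge> M0 \<Longrightarrow> \<theta> \<in> \<Theta> \<Longrightarrow> M < w \<theta> \<Longrightarrow> c \<theta> < \<eta> / 2"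
    unfolding max_less_iff_conj by blast
  define M where "M = max M0 1"
  have M: "0 < M" "\<And>\<theta>. \<theta> \<in> \<Theta> \<Longrightarrow> M < w \<theta> \<Longrightarrow> c \<theta> < \<eta> / 2"
    using M0[of M] by (auto simp: M_def)
  have "\<forall>M>0. bdd_above (e ` sublevel \<Theta> w M)"
    using pd unfolding parameter_drift_def by (elim conjE)
  with M(1) obtain eb where eb: "\<And>\<theta>. \<theta> \<in> sublevel \<Theta> w M \<Longrightarrow> e \<theta> \<le> eb"
    unfolding bdd_above_def by blast
  define E where "E = max eb 1"
  have E: "1 \<le> E" "\<And>\<theta>. \<theta> \<in> \<Theta> \<Longrightarrow> w \<theta> \<le> M \<Longrightarrow> e \<theta> \<le> E"
    using eb by (auto simp: E_def sublevel_def max_def) (meson order_trans linear)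
  \<comment> \<open>The threshold between small and large
    \<open>V x powr \<beta> / e \<theta>\<close>. Below \<open>1 / E\<close> the case
    \<open>w \<theta> \<le> M\<close> is impossible, so \<open>c \<theta> < \<eta> / 2\<close>; a
    quotient below \<open>\<eta> / 2\<close> then keeps the argument of \<open>\<Delta>\<close>
    within \<open>\<eta>\<close>.\<close>
  define h where "h = min (\<eta> / 2) (1 / E)"
  have h: "0 < h" using \<eta> E(1) by (simp add: h_def)
  have "\<forall>M>0. \<exists>K>0. \<forall>z\<ge>M. \<bar>\<Delta> z\<bar> \<le> K * z powr p"
    using pd unfolding parameter_drift_def by (elim conjE)
  with h obtain K where K: "0 < K" "\<And>z. h \<le> z \<Longrightarrow> \<bar>\<Delta> z\<bar> \<le> K * z powr p"
    by blast
  have "\<forall>\<epsilon>>0. bdd_above ((\<lambda>(\<theta>, x). a \<theta> * w \<theta> * e \<theta> powr (- p) / V x powr (\<iota> - p * \<beta>)) `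
       {(\<theta>, x). \<theta> \<in> \<Theta> \<and> x \<in> X \<and> V x powr \<beta> / e \<theta> \<ge> \<epsilon>})"
    using pd unfolding parameter_drift_def by (elim conjE)
  from spec[OF this, of h] h obtain B0 where B0: "\<And>\<theta> x. \<theta> \<in> \<Theta> \<Longrightarrow> x \<in> X \<Longrightarrow> h \<le> V x powr \<beta> / e \<theta> \<Longrightarrow>
      a \<theta> * w \<theta> * e \<theta> powr (- p) / V x powr (\<iota> - p * \<beta>) \<le> B0"
    unfolding bdd_above_def by fastforce
  \<comment> \<open>\<open>B0\<close> may bound an empty set, so it is replaced by a nonnegative
    bound. For \<open>u = V x powr \<beta> / e \<theta>\<close> above the threshold,
    \<open>c \<theta> + u \<le> L * u\<close>; then \<open>\<Delta> 0\<close> and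
    \<open>- \<Delta> (c \<theta> + u)\<close> are each at most a multiple of
    \<open>u powr p\<close>, and the two coefficients add up to \<open>Q\<close>.\<close>
  define B where "B = max B0 0"
  define L where "L = \<bar>cb\<bar> / h + 1"
  define Q where "Q = \<Delta> 0 * (1 / h) powr p + K * L powr p"
  have L: "0 < L" using h by (simp add: L_def add_nonneg_pos)
  have Q: "0 \<le> Q" using D0 K(1) by (simp add: Q_def)
  have B: "0 \<le> B" by (simp add: B_def)
  have "w \<theta> * (\<Delta> 0 - \<epsilon> - \<Delta> (c \<theta> + V x powr \<beta> / e \<theta>)) \<le> (Q * B) * (V x powr \<iota> / a \<theta>)"
    if \<theta>: "\<theta> \<in> \<Theta>" and x: "x \<in> X" for \<theta> x
  proof -
    define u where "u = V x powr \<beta> / e \<theta>"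
    have e0: "0 < e \<theta>" and w0: "0 < w \<theta>" and V0: "0 < V x"
      using e[OF \<theta>] w[OF \<theta>] V[OF x] by auto
    have u0: "0 < u" using e0 V0 by (simp add: u_def)
    show ?thesis
    proof (cases "h \<le> u")
      case False
      have "\<not> w \<theta> \<le> M"
      proof
        assume "w \<theta> \<le> M"
        then have "e \<theta> \<le> E" using E(2) \<theta> by blast
        then have "1 / E \<le> V x powr \<beta> / e \<theta>"
          using e0 ge_one_powr_ge_zero[OF V[OF x] \<beta>] by (intro frac_le) auto
        with False show False by (simp add: h_def u_def)
      qed
      then have "c \<theta> < \<eta> / 2" using M(2) \<theta> by simp
      moreover have "u < \<eta> / 2" using False by (simp add: h_def)
      ultimately have "\<Delta> 0 - \<epsilon> \<le> \<Delta> (c \<theta> + u)"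
        using c[OF \<theta>] u0 by (intro \<Delta>\<eta>) auto
      then have "w \<theta> * (\<Delta> 0 - \<epsilon> - \<Delta> (c \<theta> + u)) \<le> 0"
        using w0 by (simp add: mult_nonneg_nonpos)
      also have "0 \<le> (Q * B) * (V x powr \<iota> / a \<theta>)"
        using Q B a[OF \<theta>] by simp
      finally show ?thesis by (simp add: u_def)
    next
      case True
      have "c \<theta> \<le> \<bar>cb\<bar> * (u / h)"
      proof -
        have "c \<theta> \<le> \<bar>cb\<bar> * 1" using cb[OF \<theta>] by simp
        also have "\<dots> \<le> \<bar>cb\<bar> * (u / h)" using True h by (intro mult_left_mono) auto
        finally show ?thesis .
      qed
      then have "c \<theta> + u \<le> L * u" using h by (simp add: L_def field_simps)
      then have "(c \<theta> + u) powr p \<le> L powr p * u powr p"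
        using c[OF \<theta>] u0 p L by (subst powr_mult[symmetric]) (auto intro!: powr_mono2)
      moreover have "\<bar>\<Delta> (c \<theta> + u)\<bar> \<le> K * (c \<theta> + u) powr p"
        using K(2) True c[OF \<theta>] by simp
      ultimately have 1: "- \<Delta> (c \<theta> + u) \<le> K * (L powr p * u powr p)"
        using K(1) by (smt (verit, best) mult_left_mono)
      have "1 \<le> (1 / h * u) powr p"
        using True h p by (intro ge_one_powr_ge_zero) auto
      then have "1 \<le> (1 / h) powr p * u powr p"
        using h u0 by (subst (asm) powr_mult) auto
      then have "\<Delta> 0 * 1 \<le> \<Delta> 0 * ((1 / h) powr p * u powr p)"
        using D0 by (intro mult_left_mono) auto
      with 1 \<epsilon> have "\<Delta> 0 - \<epsilon> - \<Delta> (c \<theta> + u) \<le> Q * u powr p"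
        by (simp add: Q_def algebra_simps)
      then have "w \<theta> * (\<Delta> 0 - \<epsilon> - \<Delta> (c \<theta> + u)) \<le> w \<theta> * (Q * u powr p)"
        using w0 by (intro mult_left_mono) auto
      also have "\<dots> = Q * (w \<theta> * u powr p)" by simp
      \<comment> \<open>Writing \<open>V x powr (p * \<beta>)\<close> as
        \<open>V x powr \<iota> / V x powr (\<iota> - p * \<beta>)\<close> exposes the quotient
        bounded by \<open>B\<close>.\<close>
      also have "w \<theta> * u powr p = (a \<theta> * w \<theta> * e \<theta> powr (- p) / V x powr (\<iota> - p * \<beta>)) * (V x powr \<iota> / a \<theta>)"
        using a[OF \<theta>] V0 e0
        by (simp add: u_def powr_divide powr_powr powr_minus powr_diff field_simps)
      also have "\<dots> \<le> B * (V x powr \<iota> / a \<theta>)"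
        using B0[OF \<theta> x] True a[OF \<theta>] by (intro mult_right_mono) (auto simp: B_def u_def le_max_iff_disj)
      finally show ?thesis using Q by (simp add: u_def mult_left_mono mult.assoc)
    qed
  qed
  then show ?thesis using Q B by (intro exI[of _ "Q * B"]) auto
qed

text \<open>The step-size gap supplies \<open>- \<epsilon> * w \<theta>\<close>. One half is spent
  on comparing \<open>\<Delta>\<close> with \<open>\<Delta> 0\<close>, the other pays for
  \<open>\<delta> * w \<theta>\<close> and, on \<open>C\<close>, for
  \<open>lam * b \<theta>\<close>.\<close>

lemma joint_drift:
  fixes X C :: "'x::euclidean_space set" and \<Theta> :: "'t::euclidean_space set"
  assumes fam: "controlled_family X \<Theta> P \<phi> \<gamma>max"
    and sd: "state_drift X \<Theta> P V C a b \<iota>"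
    and pd: "parameter_drift X \<Theta> P \<phi> \<gamma>max V C a b \<iota> w \<beta> c d e \<Delta> p"
    and a0: "0 < a0" "\<forall>\<theta>\<in>\<Theta>. a0 \<le> a \<theta>" and \<epsilon>: "0 < \<epsilon>"
  shows "\<exists>lam \<delta> Ms. 1 \<le> lam \<and> 0 < \<delta> \<and> 0 < Ms \<and>
    (\<forall>\<gamma>\<in>{0<..\<gamma>max}. \<forall>\<gamma>'\<in>{0<..\<gamma>max}. 1 / \<gamma> - 1 / \<gamma>' < \<Delta> 0 - \<epsilon> \<longrightarrow>
      (\<forall>\<theta>\<in>\<Theta>. \<forall>x\<in>X. (\<theta>, x) \<notin> sublevel \<Theta> w Ms \<times> C \<longrightarrow>
        joint_op P \<phi> \<gamma> (\<lambda>\<theta> x. lam * V x + w \<theta> / \<gamma>) \<theta> x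
          \<le> ennreal (lam * V x + w \<theta> / \<gamma>' - \<delta> * (V x powr \<iota> / a \<theta> + w \<theta>))))"
proof -
  have Vm: "V \<in> borel_measurable (borel_on X)"
    and V: "\<And>x. x \<in> X \<Longrightarrow> 1 \<le> V x" and a: "\<And>\<theta>. \<theta> \<in> \<Theta> \<Longrightarrow> 0 < a \<theta>"
    and b: "\<And>\<theta>. \<theta> \<in> \<Theta> \<Longrightarrow> 0 \<le> b \<theta>" and \<iota>: "0 \<le> \<iota>" "\<iota> \<le> 1"
    and PV: "\<And>\<theta> x. \<theta> \<in> \<Theta> \<Longrightarrow> x \<in> X \<Longrightarrow> trans_op P V \<theta> x \<le>
       ennreal ((V x - V x powr \<iota> / a \<theta>) * indicator (X - C) x + b \<theta> * indicator C x)"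
    using sd unfolding state_drift_def by auto
  have wm: "w \<in> borel_measurable (borel_on \<Theta>)"
    and w: "\<And>\<theta>. \<theta> \<in> \<Theta> \<Longrightarrow> 1 \<le> w \<theta>" and d: "\<And>\<theta>. \<theta> \<in> \<Theta> \<Longrightarrow> 0 \<le> d \<theta>"
    and Pw: "\<And>\<gamma> \<theta> x. \<gamma> \<in> {0<..\<gamma>max} \<Longrightarrow> \<theta> \<in> \<Theta> \<Longrightarrow> x \<in> X \<Longrightarrow> joint_op P \<phi> \<gamma> (\<lambda>\<theta> x. w \<theta>) \<theta> x \<le>
       ennreal (w \<theta> - \<gamma> * w \<theta> *
         \<Delta> ((c \<theta> + V x powr \<beta> / e \<theta>) * indicator (X - C) x + d \<theta> * indicator C x))"
    using pd unfolding parameter_drift_def by auto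
  obtain K where K: "0 \<le> K" "\<And>\<theta> x. \<theta> \<in> \<Theta> \<Longrightarrow> x \<in> X \<Longrightarrow>
      w \<theta> * (\<Delta> 0 - \<epsilon> / 2 - \<Delta> (c \<theta> + V x powr \<beta> / e \<theta>)) \<le> K * (V x powr \<iota> / a \<theta>)"
    using parameter_drift_margin[OF sd pd, of "\<epsilon> / 2"] \<epsilon> by auto
  \<comment> \<open>The \<open>K\<close> in \<open>lam\<close> cancels the margin estimate, and the
    extra \<open>1\<close> leaves a full \<open>V x powr \<iota> / a \<theta>\<close> for the
    \<open>\<delta>\<close> term, whence \<open>\<delta> \<le> 1\<close>. The bound
    \<open>\<epsilon> / 4\<close> controls \<open>\<delta> * w \<theta>\<close>, and
    \<open>a0\<close> is used on \<open>C\<close>.\<close>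
  define lam where "lam = K + 1"
  define \<delta> where "\<delta> = min (min 1 (\<epsilon> / 4)) a0"
  have lam: "1 \<le> lam" using K(1) by (simp add: lam_def)
  have \<delta>: "0 < \<delta>" "\<delta> \<le> 1" "\<delta> \<le> \<epsilon> / 4" "\<delta> \<le> a0" using \<epsilon> a0(1) by (auto simp: \<delta>_def)
  have "\<exists>r>0. continuous_on {0..<r} \<Delta>"
    using pd unfolding parameter_drift_def by (elim conjE)
  then obtain \<eta> where \<eta>: "0 < \<eta>" and \<Delta>\<eta>: "\<And>z. z \<in> {0..\<eta>} \<Longrightarrow> \<Delta> 0 - \<epsilon> / 2 \<le> \<Delta> z"
    using continuous_lower_bound_near_0[of _ \<Delta> "\<epsilon> / 2"] half_gt_zero[OF \<epsilon>] by blast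
  have "((\<lambda>M. SUP \<theta>\<in>\<Theta> - sublevel \<Theta> w M. ennreal (max (c \<theta>) (d \<theta>))) \<longlongrightarrow> 0) at_top"
    using pd unfolding parameter_drift_def by (elim conjE)
  from tail_SUP_tendsto_0_imp_bound[OF this \<eta>] obtain M1 where
    M1: "\<And>M \<theta>. M \<ge> M1 \<Longrightarrow> \<theta> \<in> \<Theta> \<Longrightarrow> M < w \<theta> \<Longrightarrow> d \<theta> < \<eta>" by auto
  have "((\<lambda>M. SUP \<theta>\<in>\<Theta> - sublevel \<Theta> w M. ennreal (b \<theta> / w \<theta>)) \<longlongrightarrow> 0) at_top"
    using pd unfolding parameter_drift_def by (elim conjE)
  \<comment> \<open>In the combined drift \<open>b\<close> is multiplied by \<open>lam\<close>, so
    its tail bound is divided by \<open>lam\<close>.\<close>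
  from tail_SUP_tendsto_0_imp_bound[OF this, of "\<epsilon> / (4 * lam)"] \<epsilon> lam obtain M2 where
    M2: "\<And>M \<theta>. M \<ge> M2 \<Longrightarrow> \<theta> \<in> \<Theta> \<Longrightarrow> M < w \<theta> \<Longrightarrow> b \<theta> / w \<theta> < \<epsilon> / (4 * lam)" by auto
  define Ms where "Ms = max 1 (max M1 M2)"
  have "joint_op P \<phi> \<gamma> (\<lambda>\<theta> x. lam * V x + w \<theta> / \<gamma>) \<theta> x
          \<le> ennreal (lam * V x + w \<theta> / \<gamma>' - \<delta> * (V x powr \<iota> / a \<theta> + w \<theta>))"
    if \<gamma>: "\<gamma> \<in> {0<..\<gamma>max}" and \<gamma>': "\<gamma>' \<in> {0<..\<gamma>max}" and gap: "1 / \<gamma> - 1 / \<gamma>' < \<Delta> 0 - \<epsilon>"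
      and \<theta>: "\<theta> \<in> \<Theta>" and x: "x \<in> X" and out: "(\<theta>, x) \<notin> sublevel \<Theta> w Ms \<times> C" for \<gamma> \<gamma>' \<theta> x
  proof -
    define t where "t = V x powr \<iota> / a \<theta>"
    have t0: "0 \<le> t" using a[OF \<theta>] by (simp add: t_def)
    have w0: "0 < w \<theta>" using w[OF \<theta>] by simp
    have \<gamma>0: "\<gamma> \<noteq> 0" using \<gamma> by simp
    have gap': "w \<theta> / \<gamma> \<le> w \<theta> / \<gamma>' + w \<theta> * (\<Delta> 0 - \<epsilon>)"
      using mult_left_mono[OF less_imp_le[OF gap], of "w \<theta>"] w0 by (simp add: algebra_simps)
    note comb = joint_op_combination_le(1)[OF fam \<gamma> Vm V wm w \<theta> x lam PV[OF \<theta> x] Pw[OF \<gamma> \<theta> x]]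
    show ?thesis
    proof (cases "x \<in> C")
      case False
      define z where "z = c \<theta> + V x powr \<beta> / e \<theta>"
      have "w \<theta> * (\<Delta> 0 - \<epsilon> / 2 - \<Delta> z) \<le> K * t"
        using K(2)[OF \<theta> x] by (simp add: t_def z_def)
      moreover have "\<delta> * w \<theta> \<le> \<epsilon> / 4 * w \<theta>" using \<delta>(3) w0 by (intro mult_right_mono) auto
      moreover have "0 \<le> \<epsilon> * w \<theta>" using \<epsilon> w0 by simp
      moreover have "\<delta> * t \<le> 1 * t" using \<delta>(2) t0 by (intro mult_right_mono) auto
      ultimately have "lam * (V x - t) + (w \<theta> / \<gamma> - w \<theta> * \<Delta> z)
          \<le> lam * V x + w \<theta> / \<gamma>' - \<delta> * (t + w \<theta>)"
        using gap' by (simp add: lam_def algebra_simps)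
      also have "lam * (V x - t) + (w \<theta> / \<gamma> - w \<theta> * \<Delta> z)
          = lam * (V x - t) + (w \<theta> - \<gamma> * w \<theta> * \<Delta> z) / \<gamma>"
        using \<gamma>0 by (simp add: diff_divide_distrib)
      finally show ?thesis
        using comb False x by (auto simp: t_def z_def intro: order_trans ennreal_leI)
    next
      case True
      then have M: "Ms < w \<theta>" using out \<theta> by (auto simp: sublevel_def)
      then have "d \<theta> < \<eta>" using M1[of Ms \<theta>] \<theta> by (simp add: Ms_def)
      then have "\<Delta> 0 - \<epsilon> / 2 \<le> \<Delta> (d \<theta>)" using d[OF \<theta>] by (intro \<Delta>\<eta>) auto
      then have 1: "w \<theta> * (\<Delta> 0 - \<epsilon> / 2) \<le> w \<theta> * \<Delta> (d \<theta>)" using w0 by (intro mult_left_mono) auto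
      have "b \<theta> / w \<theta> < \<epsilon> / (4 * lam)" using M2[of Ms \<theta>] \<theta> M by (simp add: Ms_def)
      then have 2: "lam * b \<theta> \<le> \<epsilon> / 4 * w \<theta>" using w0 lam by (simp add: field_simps)
      have 3: "\<delta> * w \<theta> \<le> \<epsilon> / 4 * w \<theta>" using \<delta>(3) w0 by (intro mult_right_mono) auto
      \<comment> \<open>On \<open>C\<close> the drift of \<open>V\<close> leaves only
        \<open>b \<theta>\<close>, so all of \<open>lam * V x\<close> on the right is available to
        absorb \<open>\<delta> * t\<close>. This uses \<open>\<iota> \<le> 1\<close>,
        \<open>a0 \<le> a \<theta>\<close> and \<open>\<delta> \<le> a0\<close>.\<close>
      have "V x powr \<iota> \<le> V x powr 1" using V[OF x] \<iota>(2) by (intro powr_mono) auto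
      then have "V x powr \<iota> \<le> V x" using V[OF x] by simp
      then have "t \<le> V x / a0" unfolding t_def
        using a0 \<theta> V[OF x] by (intro frac_le) auto
      then have "\<delta> * t \<le> a0 * (V x / a0)" using \<delta> t0 a0(1) by (intro mult_mono) auto
      also have "\<dots> = 1 * V x" using a0(1) by simp
      also have "\<dots> \<le> lam * V x" using lam V[OF x] by (intro mult_right_mono) auto
      finally have "lam * b \<theta> + (w \<theta> / \<gamma> - w \<theta> * \<Delta> (d \<theta>))
          \<le> lam * V x + w \<theta> / \<gamma>' - \<delta> * (t + w \<theta>)"
        using 1 2 3 gap' by (simp add: algebra_simps)
      also have "lam * b \<theta> + (w \<theta> / \<gamma> - w \<theta> * \<Delta> (d \<theta>))
          = lam * b \<theta> + (w \<theta> - \<gamma> * w \<theta> * \<Delta> (d \<theta>)) / \<gamma>"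
        using \<gamma>0 by (simp add: diff_divide_distrib)
      finally show ?thesis
        using comb True by (auto simp: t_def intro: order_trans ennreal_leI)
    qed
  qed
  then show ?thesis
    using lam \<delta>(1) by (intro exI[of _ lam] exI[of _ \<delta>] exI[of _ Ms]) (auto simp: Ms_def)
qed

section \<open>Nonnegative adapted processes on the Ionescu-Tulcea path space\<close>

context Ionescu_Tulcea
begin

text \<open>The tower property: the law of the first \<open>Suc n\<close> coordinates is the law of
  the first \<open>n\<close> extended by the kernel \<open>eP n\<close>.\<close>

lemma nn_integral_lim_Suc:
  assumes f[measurable]: "f \<in> borel_measurable (PiM {0..<Suc n} M)"
  shows "(\<integral>\<^sup>+ \<omega>. f (restrict \<omega> {0..<Suc n}) \<partial>PF.lim)
    = (\<integral>\<^sup>+ \<omega>. \<integral>\<^sup>+ x. f x \<partial>eP n (restrict \<omega> {0..<n}) \<partial>PF.lim)"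
proof -
  have undef: "(\<lambda>_. undefined) \<in> space (PiM {0..<0} M)" by (simp add: space_PiM)
  \<comment> \<open>\<open>C 0 m\<close> here denotes the composition of the first \<open>m\<close>
    kernels. As \<open>{0..<m}\<close> is already an initial segment, the marginal
    \<open>CI {0..<m}\<close> is this composition itself.\<close>
  have distr: "distr PF.lim (PiM {0..<m} M) (\<lambda>\<omega>. restrict \<omega> {0..<m}) = C 0 m (\<lambda>_. undefined)" for m
  proof -
    have up: "up_to {0..<m} = m"
      using up_to_iff[of "{0..<m}" m] up_to_less[of "{0..<m}" "m - 1"] by (cases m) auto
    have "distr PF.lim (PiM {0..<m} M) (\<lambda>\<omega>. restrict \<omega> {0..<m}) = CI {0..<m}"
      by (rule distr_lim) simp
    also have "\<dots> = C 0 m (\<lambda>_. undefined)"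
      using distr_C[OF order_refl undef, of m] by (simp add: CI_def up)
    finally show ?thesis .
  qed
  have [measurable]: "(\<lambda>\<omega>. restrict \<omega> {0..<m}) \<in> PF.lim \<rightarrow>\<^sub>M PiM {0..<m} M" for m
    by (subst measurable_cong_sets[OF PF.sets_lim refl]) (auto intro!: measurable_restrict_subset)
  have "(\<integral>\<^sup>+ \<omega>. f (restrict \<omega> {0..<Suc n}) \<partial>PF.lim) = (\<integral>\<^sup>+ x. f x \<partial>C 0 (Suc n) (\<lambda>_. undefined))"
    unfolding distr[symmetric] by (subst nn_integral_distr) auto
  also have "\<dots> = (\<integral>\<^sup>+ \<omega>. \<integral>\<^sup>+ x. f x \<partial>eP n \<omega> \<partial>C 0 n (\<lambda>_. undefined))"
    using undef sets_C[OF undef, of n]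
    by (simp, subst nn_integral_bind[where B="PiM {0..<Suc n} M"]) (auto cong: measurable_cong_sets)
  also have "\<dots> = (\<integral>\<^sup>+ \<omega>. \<integral>\<^sup>+ x. f x \<partial>eP n (restrict \<omega> {0..<n}) \<partial>PF.lim)"
    unfolding distr[symmetric]
    by (subst nn_integral_distr)
       (auto intro!: nn_integral_measurable_subprob_algebra2 measurable_compose[OF measurable_eP nn_integral_measurable_subprob_algebra] f)
  finally show ?thesis .
qed

text \<open>Fix \<open>N\<close> and let \<open>?B\<close> be the event that \<open>Z k\<close> is
  at most \<open>N\<close> and the inequality holds at every time from \<open>k\<close> on. The
  integral of \<open>Z i\<close> over the event \<open>A i\<close> that this is so up to time
  \<open>i\<close> starts at no more than \<open>N\<close>, stays nonnegative, and drops at each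
  step by at least \<open>D\<close> times the probability of \<open>?B\<close>; so \<open>?B\<close>
  is null. As \<open>Z k\<close> is finite, countably many such events cover the paths on which the
  inequality never fails.\<close>

lemma AE_drift_fails_after:
  fixes Z :: "nat \<Rightarrow> (nat \<Rightarrow> 'a) \<Rightarrow> ennreal"
  assumes Z[measurable]: "\<And>n. Z n \<in> borel_measurable (PiM {0..<Suc n} M)"
    and fin: "\<And>\<omega>. \<omega> \<in> space (PiM {0..<Suc k} M) \<Longrightarrow> Z k \<omega> < top"
    and D: "0 < D"
  shows "AE \<omega> in PF.lim. \<exists>i\<ge>k. \<not> (\<integral>\<^sup>+ x. Z (Suc i) x \<partial>eP (Suc i) (restrict \<omega> {0..<Suc i})) + D
    \<le> Z i (restrict \<omega> {0..<Suc i})"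
proof -
  let ?r = "\<lambda>i \<omega>. restrict \<omega> {0..<Suc i} :: nat \<Rightarrow> 'a"
  define E where "E i \<omega> = (\<integral>\<^sup>+ x. Z (Suc i) x \<partial>eP (Suc i) \<omega>)" for i \<omega>
  define G where "G i \<omega> \<longleftrightarrow> E i \<omega> + D \<le> Z i \<omega>" for i \<omega>
  have E[measurable]: "E i \<in> borel_measurable (PiM {0..<Suc i} M)" for i
    unfolding E_def by (rule measurable_compose[OF measurable_eP nn_integral_measurable_subprob_algebra]) measurable
  have G[measurable]: "Measurable.pred (PiM {0..<Suc i} M) (G i)" for i
    unfolding G_def pred_def by (intro borel_measurable_le borel_measurable_add E Z borel_measurable_const)
  have r[measurable]: "?r i \<in> PF.lim \<rightarrow>\<^sub>M PiM {0..<Suc i} M" for i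
    by (subst measurable_cong_sets[OF PF.sets_lim refl]) (auto intro!: measurable_restrict_subset)
  have r_r[measurable]: "?r j \<in> PiM {0..<Suc i} M \<rightarrow>\<^sub>M PiM {0..<Suc j} M" if "j \<le> i" for i j
    using that by (intro measurable_restrict_subset) auto
  have r_sp: "\<omega> \<in> space PF.lim \<Longrightarrow> ?r i \<omega> \<in> space (PiM {0..<Suc i} M)" for i \<omega>
    using measurable_space[OF r] .
  \<comment> \<open>A measure whose image is a probability measure is one itself; the image taken is
    the marginal on coordinate \<open>0\<close>.\<close>
  interpret lim: prob_space PF.lim
  proof (rule prob_space_distrD[of "\<lambda>\<omega>. restrict \<omega> {0..<1}" PF.lim "PiM {0..<1} M"])
    show "prob_space (distr PF.lim (PiM {0..<1} M) (\<lambda>\<omega>. restrict \<omega> {0..<1}))"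
      by (subst distr_lim) (auto intro: PF.prob_space_P)
  qed (use r[of 0] in simp)
  have *: "emeasure PF.lim {\<omega>\<in>space PF.lim. Z k (?r k \<omega>) \<le> of_nat N \<and> (\<forall>i\<ge>k. G i (?r i \<omega>))} = 0"
    (is "emeasure _ ?B = 0") for N :: nat
  proof -
    \<comment> \<open>For \<open>k \<le> i\<close>, \<open>A i\<close> depends only on coordinates
      up to \<open>i\<close>, decreases in \<open>i\<close> and contains \<open>?B\<close>. Its
      indicator can therefore be moved out of the integral over coordinate
      \<open>Suc i\<close>.\<close>
    define A where "A i \<omega> \<longleftrightarrow> Z k (?r k \<omega>) \<le> of_nat N \<and> (\<forall>j\<in>{k..i}. G j (?r j \<omega>))" for i \<omega>
    have A_pred[measurable]: "Measurable.pred (PiM {0..<Suc i} M) (A i)" if "k \<le> i" for i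
    proof -
      have "Measurable.pred (PiM {0..<Suc i} M) (\<lambda>\<omega>. G j (?r j \<omega>))" if "j \<in> {k..i}" for j
        using that by (intro measurable_compose[OF r_r G]) auto
      moreover have "Measurable.pred (PiM {0..<Suc i} M) (\<lambda>\<omega>. Z k (?r k \<omega>) \<le> of_nat N)"
        using measurable_compose[OF r_r[OF \<open>k \<le> i\<close>] Z[of k]] by measurable
      ultimately show ?thesis unfolding A_def
        by (intro pred_intros_logic pred_intros_finite) auto
    qed
    have A_cong: "A i (?r n \<omega>) = A i \<omega>" if "k \<le> i" "i \<le> n" for i n \<omega>
    proof -
      have "?r j (?r n \<omega>) = ?r j \<omega>" if "j \<le> i" for j using that \<open>i \<le> n\<close> by (auto simp: fun_eq_iff)
      then show ?thesis using that by (auto simp: A_def)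
    qed
    have A_Suc: "A (Suc i) \<omega> \<Longrightarrow> A i \<omega>" for i \<omega> by (auto simp: A_def)
    define I where "I i = (\<integral>\<^sup>+ \<omega>. Z i (?r i \<omega>) * indicator {\<omega>. A i \<omega>} (?r i \<omega>) \<partial>PF.lim)" for i
    have step: "I (Suc i) + D * emeasure PF.lim ?B \<le> I i" if i: "k \<le> i" for i
    proof -
      have [measurable]: "{\<omega>\<in>space (PiM {0..<Suc (Suc i)} M). A (Suc i) \<omega>} \<in> sets (PiM {0..<Suc (Suc i)} M)"
        "{\<omega>\<in>space (PiM {0..<Suc i} M). A i \<omega>} \<in> sets (PiM {0..<Suc i} M)"
        using A_pred[of i] A_pred[of "Suc i"] i by (auto simp: pred_def)
      have B[measurable]: "?B \<in> sets PF.lim"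
        using measurable_compose[OF r Z] measurable_compose[OF r G] by measurable
      have ind[measurable]: "(indicator {\<omega>. A i \<omega>} :: _ \<Rightarrow> ennreal) \<in> borel_measurable (PiM {0..<Suc i} M)"
        if "k \<le> i" for i
        using A_pred[OF that] by (auto simp: indicator_def pred_def cong: measurable_cong)
      have m: "(\<lambda>x. Z (Suc i) x * indicator {\<omega>. A (Suc i) \<omega>} x) \<in> borel_measurable (PiM {0..<Suc (Suc i)} M)"
        using ind[of "Suc i"] i by measurable
      have "I (Suc i) = (\<integral>\<^sup>+ \<omega>. \<integral>\<^sup>+ x. Z (Suc i) x * indicator {\<omega>. A (Suc i) \<omega>} x \<partial>eP (Suc i) (?r i \<omega>) \<partial>PF.lim)"
        unfolding I_def by (rule nn_integral_lim_Suc[OF m])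
      also have "\<dots> \<le> (\<integral>\<^sup>+ \<omega>. E i (?r i \<omega>) * indicator {\<omega>. A i \<omega>} (?r i \<omega>) \<partial>PF.lim)"
      proof (rule nn_integral_mono)
        fix \<omega> assume "\<omega> \<in> space PF.lim"
        note sp = r_sp[OF this, of i]
        have fu: "A (Suc i) ((?r i \<omega>)(Suc i := y)) \<Longrightarrow> A i (?r i \<omega>)" for y
        proof -
          assume "A (Suc i) ((?r i \<omega>)(Suc i := y))"
          then have "A i ((?r i \<omega>)(Suc i := y))" by (rule A_Suc)
          moreover have "?r i ((?r i \<omega>)(Suc i := y)) = ?r i \<omega>" by (auto simp: fun_eq_iff)
          ultimately show ?thesis using A_cong[OF i order_refl] by metis
        qed
        have "(\<integral>\<^sup>+ x. Z (Suc i) x * indicator {\<omega>. A (Suc i) \<omega>} x \<partial>eP (Suc i) (?r i \<omega>))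
          = (\<integral>\<^sup>+ y. Z (Suc i) ((?r i \<omega>)(Suc i := y)) * indicator {\<omega>. A (Suc i) \<omega>} ((?r i \<omega>)(Suc i := y)) \<partial>P (Suc i) (?r i \<omega>))"
          by (rule nn_integral_eP[OF sp m])
        also have "\<dots> \<le> (\<integral>\<^sup>+ y. Z (Suc i) ((?r i \<omega>)(Suc i := y)) * indicator {\<omega>. A i \<omega>} (?r i \<omega>) \<partial>P (Suc i) (?r i \<omega>))"
          using fu by (intro nn_integral_mono mult_left_mono) (auto simp: indicator_def)
        also have "\<dots> = E i (?r i \<omega>) * indicator {\<omega>. A i \<omega>} (?r i \<omega>)"
          unfolding E_def by (subst nn_integral_eP[OF sp Z]) (auto simp: indicator_def)
        finally show "(\<integral>\<^sup>+ x. Z (Suc i) x * indicator {\<omega>. A (Suc i) \<omega>} x \<partial>eP (Suc i) (?r i \<omega>))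
          \<le> E i (?r i \<omega>) * indicator {\<omega>. A i \<omega>} (?r i \<omega>)" .
      qed
      finally have "I (Suc i) + D * emeasure PF.lim ?B
        \<le> (\<integral>\<^sup>+ \<omega>. E i (?r i \<omega>) * indicator {\<omega>. A i \<omega>} (?r i \<omega>) \<partial>PF.lim)
          + (\<integral>\<^sup>+ \<omega>. D * indicator ?B \<omega> \<partial>PF.lim)"
        using B by (simp add: nn_integral_cmult_indicator add_right_mono)
      also have "\<dots> = (\<integral>\<^sup>+ \<omega>. E i (?r i \<omega>) * indicator {\<omega>. A i \<omega>} (?r i \<omega>)
          + D * indicator ?B \<omega> \<partial>PF.lim)"
        using B ind[OF i] by (intro nn_integral_add[symmetric]) measurable
      also have "\<dots> \<le> I i"
        unfolding I_def
      proof (rule nn_integral_mono)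
        fix \<omega> assume \<omega>: "\<omega> \<in> space PF.lim"
        \<comment> \<open>On \<open>A i\<close> the drift inequality leaves room for
          \<open>D\<close>; off \<open>A i\<close> both indicators on the left vanish, since
          \<open>?B\<close> is contained in \<open>A i\<close>.\<close>
        show "E i (?r i \<omega>) * indicator {\<omega>. A i \<omega>} (?r i \<omega>) + D * indicator ?B \<omega>
          \<le> Z i (?r i \<omega>) * indicator {\<omega>. A i \<omega>} (?r i \<omega>)"
        proof (cases "A i \<omega>")
          case True
          then have "G i (?r i \<omega>)" using i by (auto simp: A_def)
          then have "E i (?r i \<omega>) + D \<le> Z i (?r i \<omega>)" by (simp add: G_def)
          moreover have "D * indicator ?B \<omega> \<le> D" by (simp add: indicator_def)
          ultimately show ?thesis
            using True A_cong[OF i order_refl, of \<omega>] by (auto intro: order_trans[rotated] add_left_mono)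
        next
          case False
          then have "\<omega> \<notin> ?B" by (auto simp: A_def)
          with False show ?thesis using A_cong[OF i order_refl, of \<omega>] by simp
        qed
      qed
      finally show ?thesis .
    qed
    have Ik: "I k \<le> of_nat N"
    proof -
      have "I k \<le> (\<integral>\<^sup>+ \<omega>. of_nat N \<partial>PF.lim)"
        unfolding I_def using A_cong[of k k]
        by (intro nn_integral_mono) (auto simp: indicator_def A_def)
      then show ?thesis using lim.emeasure_space_1 by simp
    qed
    \<comment> \<open>The decrements are accumulated on the left because subtraction in
      \<open>ennreal\<close> is truncated.\<close>
    have bound: "of_nat n * (D * emeasure PF.lim ?B) + I (k + n) \<le> of_nat N" for n
    proof (induction n)
      case 0
      then show ?case using Ik by simp
    next
      case (Suc n)
      have "of_nat (Suc n) * (D * emeasure PF.lim ?B) + I (k + Suc n)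
        = of_nat n * (D * emeasure PF.lim ?B) + (I (Suc (k + n)) + D * emeasure PF.lim ?B)"
        by (simp add: algebra_simps)
      also have "\<dots> \<le> of_nat n * (D * emeasure PF.lim ?B) + I (k + n)"
        by (intro add_left_mono step) simp
      finally show ?case using Suc by (rule order_trans)
    qed
    \<comment> \<open>Every natural multiple of this product is at most \<open>N\<close>, whereas
      the supremum of the multiples of a nonzero value is \<open>top\<close>.\<close>
    have "D * emeasure PF.lim ?B = 0"
    proof (rule ccontr)
      assume nz: "D * emeasure PF.lim ?B \<noteq> 0"
      have "(SUP n. of_nat n * (D * emeasure PF.lim ?B)) \<le> of_nat N"
      proof (rule SUP_least)
        fix n
        have "of_nat n * (D * emeasure PF.lim ?B) \<le> of_nat n * (D * emeasure PF.lim ?B) + I (k + n)"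
          by (simp add: add_increasing2)
        then show "of_nat n * (D * emeasure PF.lim ?B) \<le> of_nat N" using bound by (rule order_trans)
      qed
      moreover have "(SUP n. of_nat n * (D * emeasure PF.lim ?B)) = (top :: ennreal)"
        using nz by (simp add: SUP_mult_right_ennreal[symmetric] ennreal_SUP_of_nat_eq_top ennreal_top_mult)
      ultimately have "(top :: ennreal) \<le> of_nat N" by (simp only:)
      then show False by (simp add: top_unique)
    qed
    then show ?thesis using D by auto
  qed
  have "AE \<omega> in PF.lim. \<forall>N::nat. \<not> (Z k (?r k \<omega>) \<le> of_nat N \<and> (\<forall>i\<ge>k. G i (?r i \<omega>)))"
  proof (subst AE_all_countable, rule allI)
    fix N :: nat
    have "{\<omega>\<in>space PF.lim. Z k (?r k \<omega>) \<le> of_nat N \<and> (\<forall>i\<ge>k. G i (?r i \<omega>))} \<in> sets PF.lim"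
      using measurable_compose[OF r Z] measurable_compose[OF r G] by measurable
    then show "AE \<omega> in PF.lim. \<not> (Z k (?r k \<omega>) \<le> of_nat N \<and> (\<forall>i\<ge>k. G i (?r i \<omega>)))"
      using *[of N] by (intro AE_I[of _ _ "{\<omega>\<in>space PF.lim. Z k (?r k \<omega>) \<le> of_nat N \<and> (\<forall>i\<ge>k. G i (?r i \<omega>))}"]) auto
  qed
  moreover have "AE \<omega> in PF.lim. \<omega> \<in> space PF.lim" by (rule AE_space)
  ultimately show ?thesis
  proof eventually_elim
    case (elim \<omega>)
    have "Z k (?r k \<omega>) < top" by (rule fin[OF r_sp[OF elim(2)]])
    then obtain N :: nat where "Z k (?r k \<omega>) \<le> of_nat N"
      using ennreal_Ex_less_of_nat less_imp_le by blast
    then show ?case using elim(1) by (auto simp: G_def E_def)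
  qed
qed

end

section \<open>Recurrence of the controlled chain\<close>

lemma param_seq_cong:
  "(\<And>j. j \<le> n \<Longrightarrow> \<omega> j = \<omega>' j) \<Longrightarrow> param_seq \<phi> \<gamma> \<theta> \<omega> n = param_seq \<phi> \<gamma> \<theta> \<omega>' n"
  by (induction n) auto

text \<open>By contraposition, a failure of the drift inequality at a time from \<open>k\<close> on
  places the chain in \<open>S\<close>. Almost surely such a failure occurs after any given time,
  and countably many starting times give infinitely many visits. The set \<open>S\<close> itself may
  be arbitrary, as it only has to contain these failures.\<close>

lemma AE_infinitely_often_drift_fails:
  fixes \<phi> :: "real \<Rightarrow> 't::euclidean_space \<Rightarrow> 'x::euclidean_space \<Rightarrow> 't"
  assumes fam: "controlled_family X \<Theta> P \<phi> \<gamma>max"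
    and steps: "\<forall>i\<ge>1. \<gamma> i \<in> {0<..\<gamma>max}" and \<theta>: "\<theta> \<in> \<Theta>" and x: "x \<in> X"
    and F: "\<And>n. (\<lambda>(\<theta>, x). F n \<theta> x) \<in> borel_measurable (borel_on \<Theta> \<Otimes>\<^sub>M borel_on X)"
    and \<delta>: "0 < \<delta>"
    and drift: "\<And>i \<theta> x. k \<le> i \<Longrightarrow> \<theta> \<in> \<Theta> \<Longrightarrow> x \<in> X \<Longrightarrow> (\<theta>, x) \<notin> S \<Longrightarrow>
      joint_op P \<phi> (\<gamma> (Suc i)) (F (Suc i)) \<theta> x + ennreal \<delta> \<le> ennreal (F i \<theta> x)"
  shows "AE \<omega> in chain_law X P \<phi> \<gamma> \<theta> x. \<exists>\<^sub>\<infinity>i. (param_seq \<phi> \<gamma> \<theta> \<omega> i, \<omega> i) \<in> S"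
proof -
  interpret IT: Ionescu_Tulcea "chain_kernel X P \<phi> \<gamma> \<theta> x" "\<lambda>_. borel_on X"
    by (rule Ionescu_Tulcea_chain_kernel[OF fam steps \<theta> x])
  have law: "chain_law X P \<phi> \<gamma> \<theta> x = IT.PF.lim" by (simp add: chain_law_def)
  let ?\<theta> = "param_seq \<phi> \<gamma> \<theta>"
  let ?r = "\<lambda>i \<omega>. restrict \<omega> {0..<Suc i} :: nat \<Rightarrow> 'x"
  define Z where "Z n \<omega> = ennreal (F n (?\<theta> \<omega> n) (\<omega> n))" for n \<omega>
  have pair: "(\<lambda>\<omega>. (?\<theta> \<omega> n, \<omega> n)) \<in> PiM {0..<Suc n} (\<lambda>_. borel_on X) \<rightarrow>\<^sub>M borel_on \<Theta> \<Otimes>\<^sub>M borel_on X" for n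
    using measurable_param_seq[OF fam steps \<theta>]
    by (intro measurable_Pair measurable_component_singleton) auto
  have Z: "Z n \<in> borel_measurable (PiM {0..<Suc n} (\<lambda>_. borel_on X))" for n
    unfolding Z_def using measurable_compose[OF pair F[of n]] by simp
  have fails: "(?\<theta> \<omega> i, \<omega> i) \<in> S"
    if \<omega>: "\<omega> \<in> space IT.PF.lim" and i: "k \<le> i"
      and not: "\<not> (\<integral>\<^sup>+ x. Z (Suc i) x \<partial>IT.eP (Suc i) (?r i \<omega>)) + ennreal \<delta> \<le> Z i (?r i \<omega>)" for \<omega> i
  proof (rule ccontr)
    assume out: "(?\<theta> \<omega> i, \<omega> i) \<notin> S"
    have r: "?r i \<omega> \<in> space (PiM {0..<Suc i} (\<lambda>_. borel_on X))"
      using \<omega> by (auto simp: space_PiM space_restrict_space PiE_iff)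
    have \<theta>r: "?\<theta> (?r i \<omega>) i = ?\<theta> \<omega> i" by (rule param_seq_cong) auto
    have \<theta>i: "?\<theta> \<omega> i \<in> \<Theta>" and xi: "\<omega> i \<in> X"
      using measurable_space[OF pair r] \<theta>r by (auto simp: space_pair_measure space_restrict_space)
    have "(\<integral>\<^sup>+ x. Z (Suc i) x \<partial>IT.eP (Suc i) (?r i \<omega>))
        = (\<integral>\<^sup>+ y. Z (Suc i) ((?r i \<omega>)(Suc i := y)) \<partial>P (?\<theta> \<omega> i) (\<omega> i))"
      using IT.nn_integral_eP[OF r Z] by (simp add: chain_kernel_def \<theta>r)
    \<comment> \<open>Setting coordinate \<open>Suc i\<close> to \<open>y\<close> leaves the
      parameter at time \<open>i\<close> unchanged and makes the next one
      \<open>\<phi> (\<gamma> (Suc i)) (?\<theta> \<omega> i) y\<close>, which is the integrand of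
      \<open>joint_op\<close>.\<close>
    also have "\<dots> = joint_op P \<phi> (\<gamma> (Suc i)) (F (Suc i)) (?\<theta> \<omega> i) (\<omega> i)"
    proof -
      have "?\<theta> ((?r i \<omega>)(Suc i := y)) i = ?\<theta> \<omega> i" for y by (rule param_seq_cong) auto
      then show ?thesis by (simp add: Z_def joint_op_def)
    qed
    finally show False
      using not drift[OF i \<theta>i xi out] by (simp add: Z_def \<theta>r)
  qed
  have "AE \<omega> in IT.PF.lim. \<exists>i\<ge>m. (?\<theta> \<omega> i, \<omega> i) \<in> S" for m
  proof -
    \<comment> \<open>Starting at \<open>max k m\<close> ensures both that the drift hypothesis
      applies and that the visit is no earlier than \<open>m\<close>.\<close>
    have "AE \<omega> in IT.PF.lim. \<exists>i\<ge>max k m.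
      \<not> (\<integral>\<^sup>+ x. Z (Suc i) x \<partial>IT.eP (Suc i) (?r i \<omega>)) + ennreal \<delta> \<le> Z i (?r i \<omega>)"
      using \<delta> by (intro IT.AE_drift_fails_after Z) (auto simp: Z_def)
    moreover have "AE \<omega> in IT.PF.lim. \<omega> \<in> space IT.PF.lim" by (rule AE_space)
    ultimately show ?thesis
    proof eventually_elim
      case (elim \<omega>)
      then show ?case using fails[OF elim(2)] by (meson max.boundedE)
    qed
  qed
  then show ?thesis
    unfolding law INFM_nat_le by (simp add: AE_all_countable)
qed

section \<open>Combination of the drift inequality with the recurrence argument\<close>

theorem corollary1:
  fixes X C :: "'x::euclidean_space set" and \<Theta> :: "'t::euclidean_space set"
    and P :: "'t \<Rightarrow> 'x \<Rightarrow> 'x measure" and \<phi> :: "real \<Rightarrow> 't \<Rightarrow> 'x \<Rightarrow> 't"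
    and \<gamma>max \<iota> \<beta> p :: real and \<gamma>s :: "nat \<Rightarrow> real"
    and V :: "'x \<Rightarrow> real" and a b c d e w :: "'t \<Rightarrow> real" and \<Delta> :: "real \<Rightarrow> real"
  assumes "0 < \<gamma>max" and "\<forall>i\<ge>1. \<gamma>s i \<in> {0<..\<gamma>max}"
    and "controlled_family X \<Theta> P \<phi> \<gamma>max"
    and "state_drift X \<Theta> P V C a b \<iota>"
    and "parameter_drift X \<Theta> P \<phi> \<gamma>max V C a b \<iota> w \<beta> c d e \<Delta> p"
    and "C = X \<longrightarrow> (\<exists>a0>0. \<forall>\<theta>\<in>\<Theta>. a0 \<le> a \<theta>)"
    and "ereal (\<Delta> 0) - limsup (\<lambda>i. ereal (1 / \<gamma>s (i + 1) - 1 / \<gamma>s i)) > 0"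
  shows "\<forall>\<epsilon>>0. ereal \<epsilon> < ereal (\<Delta> 0) - limsup (\<lambda>i. ereal (1 / \<gamma>s (i + 1) - 1 / \<gamma>s i)) \<longrightarrow>
    (\<exists>lam \<delta> Ms. 1 \<le> lam \<and> 0 < \<delta> \<and> 0 < Ms \<and>
      (\<forall>\<gamma>\<in>{0<..\<gamma>max}. \<forall>\<gamma>'\<in>{0<..\<gamma>max}. 1 / \<gamma> - 1 / \<gamma>' < \<Delta> 0 - \<epsilon> \<longrightarrow>
        (\<forall>\<theta>\<in>\<Theta>. \<forall>x\<in>X. (\<theta>, x) \<notin> sublevel \<Theta> w Ms \<times> C \<longrightarrow>
          joint_op P \<phi> \<gamma> (\<lambda>\<theta> x. lam * V x + w \<theta> / \<gamma>) \<theta> x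
            \<le> ennreal (lam * V x + w \<theta> / \<gamma>' - \<delta> * (V x powr \<iota> / a \<theta> + w \<theta>)))) \<and>
      (\<forall>\<theta>\<in>\<Theta>. \<forall>x\<in>X. AE \<omega> in chain_law X P \<phi> \<gamma>s \<theta> x.
        \<exists>\<^sub>\<infinity>i. (param_seq \<phi> \<gamma>s \<theta> \<omega> i, \<omega> i) \<in> sublevel \<Theta> w Ms \<times> C))"
proof (intro allI impI)
  fix \<epsilon> :: real
  let ?g = "\<lambda>i. 1 / \<gamma>s (i + 1) - 1 / \<gamma>s i"
  assume \<epsilon>: "0 < \<epsilon>" "ereal \<epsilon> < ereal (\<Delta> 0) - limsup (\<lambda>i. ereal (?g i))"
  \<comment> \<open>The limsup may be \<open>-\<infinity>\<close>, so the rearrangement is done by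
    cases on an extended real.\<close>
  have "L < ereal (\<Delta> 0 - \<epsilon>)" if "ereal \<epsilon> < ereal (\<Delta> 0) - L" for L
    using that by (cases L) auto
  with \<epsilon>(2) have "limsup (\<lambda>i. ereal (?g i)) < ereal (\<Delta> 0 - \<epsilon>)"
    by blast
  then have "eventually (\<lambda>i. ereal (?g i) < ereal (\<Delta> 0 - \<epsilon>)) sequentially"
    by (rule Limsup_lessD)
  then obtain k0 where k0: "\<And>i. k0 \<le> i \<Longrightarrow> ?g i < \<Delta> 0 - \<epsilon>"
    unfolding eventually_sequentially by auto
  \<comment> \<open>For \<open>C \<noteq> X\<close> the lower bound follows from the drift of
    \<open>V\<close>; for \<open>C = X\<close> it is the assumption on \<open>a\<close>.\<close>
  obtain a0 where a0: "0 < a0" "\<forall>\<theta>\<in>\<Theta>. a0 \<le> a \<theta>"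
    using assms(6) state_drift_lower_bound[OF assms(3,4)] by metis
  from joint_drift[OF assms(3-5) a0 \<epsilon>(1)] obtain lam \<delta> Ms
    where lam: "1 \<le> lam" and \<delta>: "0 < \<delta>" and Ms: "0 < Ms"
      and drift: "\<forall>\<gamma>\<in>{0<..\<gamma>max}. \<forall>\<gamma>'\<in>{0<..\<gamma>max}. 1 / \<gamma> - 1 / \<gamma>' < \<Delta> 0 - \<epsilon> \<longrightarrow>
        (\<forall>\<theta>\<in>\<Theta>. \<forall>x\<in>X. (\<theta>, x) \<notin> sublevel \<Theta> w Ms \<times> C \<longrightarrow>
          joint_op P \<phi> \<gamma> (\<lambda>\<theta> x. lam * V x + w \<theta> / \<gamma>) \<theta> x
            \<le> ennreal (lam * V x + w \<theta> / \<gamma>' - \<delta> * (V x powr \<iota> / a \<theta> + w \<theta>)))"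
    by (elim exE conjE) blast
  have Vm: "V \<in> borel_measurable (borel_on X)" and V: "\<And>x. x \<in> X \<Longrightarrow> 1 \<le> V x"
    using assms(4) unfolding state_drift_def by auto
  have wm: "w \<in> borel_measurable (borel_on \<Theta>)" and w: "\<And>\<theta>. \<theta> \<in> \<Theta> \<Longrightarrow> 1 \<le> w \<theta>"
    using assms(5) unfolding parameter_drift_def by auto
  define F where "F n \<theta> x = lam * V x + w \<theta> / \<gamma>s n" for n \<theta> x
  have F: "(\<lambda>(\<theta>, x). F n \<theta> x) \<in> borel_measurable (borel_on \<Theta> \<Otimes>\<^sub>M borel_on X)" for n
    using measurable_compose[OF measurable_fst wm] measurable_compose[OF measurable_snd Vm]
    unfolding F_def split_beta by (intro borel_measurable_add borel_measurable_times borel_measurable_divide) auto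
  \<comment> \<open>The drift inequality with \<open>\<gamma>s (Suc i)\<close> and
    \<open>\<gamma>s i\<close> as its two step sizes. The time is at least \<open>1\<close> because
    \<open>\<gamma>s 0\<close> is unconstrained.\<close>
  have F_drift: "joint_op P \<phi> (\<gamma>s (Suc i)) (F (Suc i)) \<theta> x + ennreal \<delta> \<le> ennreal (F i \<theta> x)"
    if i: "max k0 1 \<le> i" and \<theta>: "\<theta> \<in> \<Theta>" and x: "x \<in> X" and out: "(\<theta>, x) \<notin> sublevel \<Theta> w Ms \<times> C" for i \<theta> x
  proof -
    have \<gamma>: "\<gamma>s (Suc i) \<in> {0<..\<gamma>max}" "\<gamma>s i \<in> {0<..\<gamma>max}" using assms(2) i by auto
    have PV: "trans_op P V \<theta> x \<le> ennreal ((V x - V x powr \<iota> / a \<theta>) * indicator (X - C) x + b \<theta> * indicator C x)"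
      using assms(4) \<theta> x unfolding state_drift_def by auto
    have Pw: "joint_op P \<phi> (\<gamma>s (Suc i)) (\<lambda>\<theta> x. w \<theta>) \<theta> x \<le> ennreal (w \<theta> - \<gamma>s (Suc i) * w \<theta> *
         \<Delta> ((c \<theta> + V x powr \<beta> / e \<theta>) * indicator (X - C) x + d \<theta> * indicator C x))"
      using assms(5) \<gamma>(1) \<theta> x unfolding parameter_drift_def by auto
    have one: "1 \<le> joint_op P \<phi> (\<gamma>s (Suc i)) (F (Suc i)) \<theta> x"
      unfolding F_def using joint_op_combination_le(2)[OF assms(3) \<gamma>(1) Vm V wm w \<theta> x lam PV Pw] .
    have "joint_op P \<phi> (\<gamma>s (Suc i)) (F (Suc i)) \<theta> x
        \<le> ennreal (F i \<theta> x - \<delta> * (V x powr \<iota> / a \<theta> + w \<theta>))"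
      unfolding F_def using drift k0[of i] i \<gamma> \<theta> x out by simp
    \<comment> \<open>Since \<open>w \<ge> 1\<close>, the decrement is at least the constant
      \<open>\<delta>\<close>.\<close>
    also have "\<dots> \<le> ennreal (F i \<theta> x - \<delta>)"
    proof (rule ennreal_leI)
      have "0 \<le> V x powr \<iota> / a \<theta>" using a0 \<theta> by (smt (verit) divide_nonneg_pos powr_ge_zero)
      then have "\<delta> * 1 \<le> \<delta> * (V x powr \<iota> / a \<theta> + w \<theta>)"
        using w[OF \<theta>] \<delta> by (intro mult_left_mono) auto
      then show "F i \<theta> x - \<delta> * (V x powr \<iota> / a \<theta> + w \<theta>) \<le> F i \<theta> x - \<delta>" by simp
    qed
    finally have le: "joint_op P \<phi> (\<gamma>s (Suc i)) (F (Suc i)) \<theta> x \<le> ennreal (F i \<theta> x - \<delta>)" .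
    \<comment> \<open>This excludes truncation by \<open>ennreal\<close>, so \<open>\<delta>\<close>
      can be moved to the other side as a summand.\<close>
    have "1 \<le> F i \<theta> x - \<delta>" using order_trans[OF one le] ennreal_le_iff2[of 1 "F i \<theta> x - \<delta>"] by auto
    then have "ennreal (F i \<theta> x) = ennreal (F i \<theta> x - \<delta>) + ennreal \<delta>"
      using \<delta> by (simp add: ennreal_plus[symmetric] del: ennreal_plus)
    then show ?thesis using le by (simp add: add_right_mono)
  qed
  have "\<forall>\<theta>\<in>\<Theta>. \<forall>x\<in>X. AE \<omega> in chain_law X P \<phi> \<gamma>s \<theta> x.
      \<exists>\<^sub>\<infinity>i. (param_seq \<phi> \<gamma>s \<theta> \<omega> i, \<omega> i) \<in> sublevel \<Theta> w Ms \<times> C"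
  proof (intro ballI)
    fix \<theta> x assume "\<theta> \<in> \<Theta>" "x \<in> X"
    from assms(3,2) this F \<delta> F_drift
    show "AE \<omega> in chain_law X P \<phi> \<gamma>s \<theta> x.
        \<exists>\<^sub>\<infinity>i. (param_seq \<phi> \<gamma>s \<theta> \<omega> i, \<omega> i) \<in> sublevel \<Theta> w Ms \<times> C"
      by (rule AE_infinitely_often_drift_fails)
  qed
  with lam \<delta> Ms drift show "\<exists>lam \<delta> Ms. 1 \<le> lam \<and> 0 < \<delta> \<and> 0 < Ms \<and>
      (\<forall>\<gamma>\<in>{0<..\<gamma>max}. \<forall>\<gamma>'\<in>{0<..\<gamma>max}. 1 / \<gamma> - 1 / \<gamma>' < \<Delta> 0 - \<epsilon> \<longrightarrow>
        (\<forall>\<theta>\<in>\<Theta>. \<forall>x\<in>X. (\<theta>, x) \<notin> sublevel \<Theta> w Ms \<times> C \<longrightarrow>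
          joint_op P \<phi> \<gamma> (\<lambda>\<theta> x. lam * V x + w \<theta> / \<gamma>) \<theta> x
            \<le> ennreal (lam * V x + w \<theta> / \<gamma>' - \<delta> * (V x powr \<iota> / a \<theta> + w \<theta>)))) \<and>
      (\<forall>\<theta>\<in>\<Theta>. \<forall>x\<in>X. AE \<omega> in chain_law X P \<phi> \<gamma>s \<theta> x.
        \<exists>\<^sub>\<infinity>i. (param_seq \<phi> \<gamma>s \<theta> \<omega> i, \<omega> i) \<in> sublevel \<Theta> w Ms \<times> C)"
    by (intro exI[of _ lam] exI[of _ \<delta>] exI[of _ Ms] conjI)
qed

end
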